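(* In the setting of the context, let $G=(V,E)$ be the graph defined by taking $(u,v)\in E$ iff $v\in N(u)$, where $N(u)$ is the neighbor set computed by Algorithm SMECN run at node $u$. Then $G$ has the minimum-energy property.
   Context: Setting: $V$ is a finite set of nodes located at pairwise distinct points of the plane; $\mathrm{Loc}(v)$ is the location of $v$ and $d$ is Euclidean distance. Fix constants $t>0$, $n\ge 2$ and $c>0$. Transmitting from $u$ to $v$ takes power $p(u,v)=t\,d(u,v)^n$; a reception takes power $c$. $G'=(V,E')$ is a directed graph without self-loops, where $(u,v)\in E'$ means that $u$ can transmit to $v$ when $u$ uses the maximum power $p_{max}$ (this implies $t\,d(u,v)^n\le p_{max}$). $G'$ is assumed (strongly) connected: for every pair of nodes $u,v$ there is a path in $G'$ from $u$ to $v$. The region of the plane that can be reached from $u$ with power $p\le p_{max}$ is $F(u,p)$, with $F(u,p)\subseteq F(u,p')$ for $p\le p'$; for $v\neq u$, $(u,v)\in E'$ iff $\mathrm{Loc}(v)\in F(u,p_{max})$. The cost of a path $r=(u_0,\dots,u_k)$ is $C(r)=\sum_{i=0}^{k-1}(p(u_i,u_{i+1})+c)$, and its length is $|r|=k$. A path in $G'$ from $u$ to $v$ is a minimum-energy path if its cost is minimal among all paths in $G'$ from $u$ to $v$. A subgraph $G=(V,E)$ of $G'$ has the minimum-energy property if for all $u,v\in V$ there is a path in $G$ that is a minimum-energy path in $G'$ from $u$ to $v$. For a point $(x,y)$ of the plane, $C(u,(x,y))=t\,d(u,(x,y))^n+c$ and $C(u,w,(x,y))=t\,d(u,w)^n+t\,d(w,(x,y))^n+2c$.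 The relay region of $(u,w)$ is $R_{u\to w}=\{(x,y):C(u,w,(x,y))\le C(u,(x,y))\}$. An edge $(u,v)\in E'$ is 2-redundant if there is a path $r$ in $G'$ from $u$ to $v$ with $|r|=2$ and $C(r)\le C(u,v)$. Standing assumption: if $(u,v)\in E'$ and $\mathrm{Loc}(v)\in R_{u\to w}$ for a node $w\in V$, then $(u,v)$ is 2-redundant. Algorithm SMECN at node $u$ uses an initial power $p_0$ and a function $\mathrm{Increase}$ on powers (with values at most $p_{max}$) such that $\mathrm{Increase}^k(p_0)=p_{max}$ for all sufficiently large $k$, and $F(u,p_0)\not\supseteq F(u,p_{max})$. It is: 1. Set $p=p_0$, $A=\emptyset$, $\mathit{NonNbrs}=\emptyset$, $\eta=F(u,p_{max})$. 2. While $F(u,p)\not\supseteq\eta$ do: (a) $p:=\mathrm{Increase}(p)$; (b) $M:=\{v\in V:\mathrm{Loc}(v)\in F(u,p),\ v\notin A,\ v\ne u\}$ (the new nodes found by a broadcast with power $p$); (c) $A:=A\cup M$; (d) for each $v\in M$ and each $w\in A$: if $\mathrm{Loc}(v)\in R_{u\to w}$ then $\mathit{NonNbrs}:=\mathit{NonNbrs}\cup\{v\}$, else if $\mathrm{Loc}(w)\in R_{u\to v}$ then $\mathit{NonNbrs}:=\mathit{NonNbrs}\cup\{w\}$; (e) $\eta:=\eta\cap\bigcap_{v\in M}\bigl(F(u,p_{max})\setminus R_{u\to v}\bigr)$ (the inner intersection being $F(u,p_{max})$ if $M=\emptyset$). 3. Output $N(u)=A\setminus\mathit{NonNbrs}$.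 *)

theory Defs
  imports
    "HOL-Analysis.Analysis"
    "HOL-Library.While_Combinator"
    "Graph_Theory.Arc_Walk"
    "Graph_Theory.Digraph_Component"
    "Graph_Theory.Pair_Digraph"
begin

type_synonym plane = "real^2"

text \<open>
  Costs depend on the locations of the nodes, the constant \<open>t\<close>, the real path-loss
  exponent \<open>n\<close> and the reception power \<open>c\<close>. Note that \<open>0 powr n = 0\<close>, so a zero distance costs
  no transmission power.
\<close>

definition transmit_power :: "real \<Rightarrow> real \<Rightarrow> plane \<Rightarrow> plane \<Rightarrow> real" where
  "transmit_power t n x y = t * dist x y powr n"

text \<open>
  A path \<open>(u\<^sub>0, \<dots>, u\<^sub>k)\<close> is represented by its list of arcs
  \<open>[(u\<^sub>0, u\<^sub>1), \<dots>, (u\<^bsub>k-1\<^esub>, u\<^sub>k)]\<close>, so that its length is the length of the list. Paths are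
  the arc walks of the graph library: nodes may repeat, and the empty list is the path
  of length 0 from a node to itself.
\<close>

definition path_cost :: "('a \<Rightarrow> plane) \<Rightarrow> real \<Rightarrow> real \<Rightarrow> real \<Rightarrow> ('a \<times> 'a) awalk \<Rightarrow> real" where
  "path_cost Loc t n c r = (\<Sum>(x, y)\<leftarrow>r. transmit_power t n (Loc x) (Loc y) + c)"

definition minimum_energy_path ::
  "('a \<Rightarrow> plane) \<Rightarrow> real \<Rightarrow> real \<Rightarrow> real \<Rightarrow> 'a pair_pre_digraph \<Rightarrow> 'a \<Rightarrow> ('a \<times> 'a) awalk \<Rightarrow> 'a \<Rightarrow> bool"
where
  "minimum_energy_path Loc t n c G' u r v \<longleftrightarrow>
     pre_digraph.awalk G' u r v \<and>
     (\<forall>r'. pre_digraph.awalk G' u r' v \<longrightarrow> path_cost Loc t n c r \<le> path_cost Loc t n c r')"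

definition minimum_energy_property ::
  "('a \<Rightarrow> plane) \<Rightarrow> real \<Rightarrow> real \<Rightarrow> real \<Rightarrow> 'a pair_pre_digraph \<Rightarrow> 'a pair_pre_digraph \<Rightarrow> bool"
where
  "minimum_energy_property Loc t n c G' G \<longleftrightarrow>
     spanning G G' \<and>
     (\<forall>u\<in>pverts G'. \<forall>v\<in>pverts G'.
        \<exists>r. pre_digraph.awalk G u r v \<and> minimum_energy_path Loc t n c G' u r v)"

definition direct_cost :: "('a \<Rightarrow> plane) \<Rightarrow> real \<Rightarrow> real \<Rightarrow> real \<Rightarrow> 'a \<Rightarrow> plane \<Rightarrow> real" where
  "direct_cost Loc t n c u z = transmit_power t n (Loc u) z + c"

definition relay_cost :: "('a \<Rightarrow> plane) \<Rightarrow> real \<Rightarrow> real \<Rightarrow> real \<Rightarrow> 'a \<Rightarrow> 'a \<Rightarrow> plane \<Rightarrow> real" where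
  "relay_cost Loc t n c u w z =
     transmit_power t n (Loc u) (Loc w) + transmit_power t n (Loc w) z + 2 * c"

definition relay_region :: "('a \<Rightarrow> plane) \<Rightarrow> real \<Rightarrow> real \<Rightarrow> real \<Rightarrow> 'a \<Rightarrow> 'a \<Rightarrow> plane set" where
  "relay_region Loc t n c u w = {z. relay_cost Loc t n c u w z \<le> direct_cost Loc t n c u z}"

definition two_redundant ::
  "('a \<Rightarrow> plane) \<Rightarrow> real \<Rightarrow> real \<Rightarrow> real \<Rightarrow> 'a pair_pre_digraph \<Rightarrow> 'a \<times> 'a \<Rightarrow> bool"
where
  "two_redundant Loc t n c G' e \<longleftrightarrow>
     e \<in> parcs G' \<and>
     (\<exists>r. pre_digraph.awalk G' (fst e) r (snd e) \<and> length r = 2 \<and>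
          path_cost Loc t n c r \<le> path_cost Loc t n c [e])"

record 'a smecn_state =
  cur_power :: real
  found :: "'a set"
  non_nbrs :: "'a set"
  eta :: "plane set"

definition smecn_init ::
  "('a \<Rightarrow> real \<Rightarrow> plane set) \<Rightarrow> real \<Rightarrow> ('a \<Rightarrow> real) \<Rightarrow> 'a \<Rightarrow> 'a smecn_state"
where
  "smecn_init F pmax p0 u =
     \<lparr>cur_power = p0 u, found = {}, non_nbrs = {}, eta = F u pmax\<rparr>"

definition smecn_continue :: "('a \<Rightarrow> real \<Rightarrow> plane set) \<Rightarrow> 'a \<Rightarrow> 'a smecn_state \<Rightarrow> bool" where
  "smecn_continue F u s \<longleftrightarrow> \<not> F u (cur_power s) \<supseteq> eta s"

text \<open>
  The tests of the inner double loop over \<open>v \<in> M\<close> and \<open>w \<in> A\<close> do not look at the set of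
  non-neighbours computed so far, so the loop adds the same nodes in whatever order the pairs
  are visited. These nodes are collected in the two sets below, one for each branch of the
  conditional.
\<close>

definition smecn_step ::
  "'a set \<Rightarrow> ('a \<Rightarrow> plane) \<Rightarrow> real \<Rightarrow> real \<Rightarrow> real \<Rightarrow> ('a \<Rightarrow> real \<Rightarrow> plane set) \<Rightarrow> real \<Rightarrow>
   ('a \<Rightarrow> real \<Rightarrow> real) \<Rightarrow> 'a \<Rightarrow> 'a smecn_state \<Rightarrow> 'a smecn_state"
where
  "smecn_step V Loc t n c F pmax Increase u s =
     (let R = relay_region Loc t n c u;
          p = Increase u (cur_power s);
          M = {v \<in> V. Loc v \<in> F u p \<and> v \<notin> found s \<and> v \<noteq> u};
          A = found s \<union> M
      in \<lparr>cur_power = p,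
          found = A,
          non_nbrs = non_nbrs s
            \<union> {v. \<exists>w. v \<in> M \<and> w \<in> A \<and> Loc v \<in> R w}
            \<union> {w. \<exists>v. v \<in> M \<and> w \<in> A \<and> Loc v \<notin> R w \<and> Loc w \<in> R v},
          eta = eta s \<inter> (F u pmax \<inter> (\<Inter>v\<in>M. F u pmax - R v))\<rparr>)"

definition smecn_nbrs ::
  "'a set \<Rightarrow> ('a \<Rightarrow> plane) \<Rightarrow> real \<Rightarrow> real \<Rightarrow> real \<Rightarrow> ('a \<Rightarrow> real \<Rightarrow> plane set) \<Rightarrow> real \<Rightarrow>
   ('a \<Rightarrow> real) \<Rightarrow> ('a \<Rightarrow> real \<Rightarrow> real) \<Rightarrow> 'a \<Rightarrow> 'a set"
where
  "smecn_nbrs V Loc t n c F pmax p0 Increase u =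
     (let s = while (smecn_continue F u) (smecn_step V Loc t n c F pmax Increase u)
                (smecn_init F pmax p0 u)
      in found s - non_nbrs s)"

definition smecn_graph ::
  "'a set \<Rightarrow> ('a \<Rightarrow> plane) \<Rightarrow> real \<Rightarrow> real \<Rightarrow> real \<Rightarrow> ('a \<Rightarrow> real \<Rightarrow> plane set) \<Rightarrow> real \<Rightarrow>
   ('a \<Rightarrow> real) \<Rightarrow> ('a \<Rightarrow> real \<Rightarrow> real) \<Rightarrow> 'a pair_pre_digraph"
where
  "smecn_graph V Loc t n c F pmax p0 Increase =
     \<lparr>pverts = V, parcs = {(u, v). u \<in> V \<and> v \<in> smecn_nbrs V Loc t n c F pmax p0 Increase u}\<rparr>"

end

theory Submission
  imports Defs
begin

text \<open>
  Among the minimum-energy paths of \<open>G'\<close> between two given nodes choose a longest one; it exists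
  because every arc costs at least \<open>c > 0\<close>. It contains no 2-redundant arc, as replacing such an arc
  by a two-arc detour would not raise the cost but lengthen the path. So it suffices that SMECN keeps
  every arc \<open>(u, v)\<close> that is not 2-redundant. The loop stops at the latest when the power
  is \<open>pmax\<close>. On exit \<open>\<eta>\<close>, which is the reachable region minus the relay regions of the nodes
  found, lies in \<open>F(u, p)\<close>; as \<open>v\<close> lies in no relay region, it belongs to \<open>\<eta>\<close>, so it has been found,
  and for the same reason it has never been discarded.
\<close>

lemma path_cost_append:
  "path_cost Loc t n c (r @ s) = path_cost Loc t n c r + path_cost Loc t n c s"
  by (simp add: path_cost_def)

text \<open>Transmission power is nonnegative, so each arc contributes at least \<open>c\<close>.
  With \<open>c > 0\<close> this turns a bound on the cost into a bound on the length.\<close>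

lemma length_le_path_cost:
  assumes "t \<ge> 0"
  shows "c * real (length r) \<le> path_cost Loc t n c r"
proof (induction r)
  case (Cons e r)
  have "0 \<le> transmit_power t n (Loc (fst e)) (Loc (snd e))"
    using assms by (simp add: transmit_power_def)
  with Cons show ?case
    by (simp add: path_cost_def algebra_simps split_beta)
qed (simp add: path_cost_def)

text \<open>Walks may repeat nodes, so there can be infinitely many from \<open>u\<close> to
  \<open>v\<close>. A cost of at most \<open>b\<close> caps the length at \<open>b / c\<close>, and
  over a finite arc set there are only finitely many such lists.\<close>

lemma finite_bounded_cost_paths:
  assumes "finite (parcs G)" "t \<ge> 0" "c > 0"
  shows "finite {r. pre_digraph.awalk (with_proj G) u r v \<and> path_cost Loc t n c r \<le> b}"
proof (rule finite_subset)
  show "{r. pre_digraph.awalk (with_proj G) u r v \<and> path_cost Loc t n c r \<le> b}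
    \<subseteq> {r. set r \<subseteq> parcs G \<and> length r \<le> nat \<lfloor>b / c\<rfloor>}"
  proof safe
    fix r e
    assume "pre_digraph.awalk (with_proj G) u r v" "e \<in> set r"
    then show "e \<in> parcs G"
      by (auto simp: pre_digraph.awalk_def)
  next
    fix r
    assume "path_cost Loc t n c r \<le> b"
    then have "c * real (length r) \<le> b"
      using length_le_path_cost[OF assms(2), of c r Loc n] by linarith
    then have "real (length r) \<le> b / c"
      using assms(3) by (simp add: field_simps)
    then show "length r \<le> nat \<lfloor>b / c\<rfloor>"
      by (simp add: le_nat_floor)
  qed
  show "finite {r. set r \<subseteq> parcs G \<and> length r \<le> nat \<lfloor>b / c\<rfloor>}"
    using assms(1) by (rule finite_lists_length_le)
qed

lemma ex_longest_minimum_energy_path: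
  assumes "finite (parcs G)" "t \<ge> 0" "c > 0" and r0: "pre_digraph.awalk (with_proj G) u r0 v"
  obtains r where "minimum_energy_path Loc t n c G u r v"
    and "\<And>r'. minimum_energy_path Loc t n c G u r' v \<Longrightarrow> length r' \<le> length r"
proof -
  let ?C = "path_cost Loc t n c"
  let ?S = "{r. pre_digraph.awalk (with_proj G) u r v \<and> ?C r \<le> ?C r0}"
  let ?T = "{r. minimum_energy_path Loc t n c G u r v}"
  have fin: "finite ?S"
    using assms by (intro finite_bounded_cost_paths)
  have "r0 \<in> ?S"
    using r0 by simp
  then obtain m where m: "m \<in> ?S" and least: "\<And>r. r \<in> ?S \<Longrightarrow> ?C m \<le> ?C r"
    using ex_is_arg_min_if_finite[OF fin, of ?C] by (auto simp: is_arg_min_linorder)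
  \<comment> \<open>A walk outside \<open>?S\<close> costs more than \<open>r0\<close>, hence more
    than \<open>m\<close>.\<close>
  have "?C m \<le> ?C r" if "pre_digraph.awalk (with_proj G) u r v" for r
    using that m least[of r] by (cases "?C r \<le> ?C r0") auto
  then have "m \<in> ?T"
    using m by (auto simp: minimum_energy_path_def)
  moreover have "?T \<subseteq> ?S"
    using r0 by (auto simp: minimum_energy_path_def)
  then have "finite ?T"
    using fin by (rule finite_subset)
  ultimately have "Max (length ` ?T) \<in> length ` ?T" and "\<And>r. r \<in> ?T \<Longrightarrow> length r \<le> Max (length ` ?T)"
    by (auto intro: Max_in)
  then show ?thesis
    using that by (metis (no_types, lifting) imageE mem_Collect_eq)
qed

text \<open>Minimality alone does not exclude such an arc, since a detour of equal cost also makes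
  it 2-redundant; maximal length settles this case. The detour may revisit nodes, which is harmless
  for arc walks.\<close>

lemma longest_minimum_energy_path_not_two_redundant:
  assumes wf: "pair_wf_digraph G"
    and r: "minimum_energy_path Loc t n c G u r v"
    and longest: "\<And>r'. minimum_energy_path Loc t n c G u r' v \<Longrightarrow> length r' \<le> length r"
    and e: "e \<in> set r"
  shows "\<not> two_redundant Loc t n c G e"
proof
  interpret pair_wf_digraph G by (rule wf)
  assume "two_redundant Loc t n c G e"
  then obtain q where q: "awalk (fst e) q (snd e)" "length q = 2"
      "path_cost Loc t n c q \<le> path_cost Loc t n c [e]"
    by (auto simp: two_redundant_def)
  obtain a b where r_eq: "r = a @ [e] @ b"
    using e by (auto simp: in_set_conv_decomp)
  have "awalk u (a @ [e] @ b) v"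
    using r by (simp add: minimum_energy_path_def r_eq)
  then have "awalk u a (fst e)" "awalk (snd e) b v"
    by (auto simp: awalk_append_iff awalk_Cons_iff dest: awlast_if_cas)
  then have walk: "awalk u (a @ q @ b) v"
    using q(1) by (blast intro: awalk_appendI)
  have "path_cost Loc t n c (a @ q @ b) \<le> path_cost Loc t n c r"
    \<comment> \<open>The simplifier turns \<open>[e] @ b\<close> into \<open>e # b\<close>; the
      extra instance splits the cost in that form.\<close>
    using q(3) by (simp add: r_eq path_cost_append path_cost_append[of _ _ _ _ "[e]" b, simplified])
  then have "minimum_energy_path Loc t n c G u (a @ q @ b) v"
    using r walk unfolding minimum_energy_path_def by (meson order_trans)
  from longest[OF this] show False
    using q(2) by (simp add: r_eq)
qed

text \<open>Either branch of the conditional discards a node because it lies in the relay region of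
  a found node, and only this is remembered. The successive cuts of \<open>eta\<close> become one
  intersection over all nodes found so far.\<close>

definition smecn_invariant ::
  "'a set \<Rightarrow> ('a \<Rightarrow> plane) \<Rightarrow> real \<Rightarrow> real \<Rightarrow> real \<Rightarrow> ('a \<Rightarrow> real \<Rightarrow> plane set) \<Rightarrow> real \<Rightarrow>
   'a \<Rightarrow> 'a smecn_state \<Rightarrow> bool"
where
  "smecn_invariant V Loc t n c F pmax u s \<longleftrightarrow>
     cur_power s \<le> pmax \<and>
     found s \<subseteq> {v \<in> V. v \<noteq> u \<and> Loc v \<in> F u pmax} \<and>
     non_nbrs s \<subseteq> {v. \<exists>w\<in>V. Loc v \<in> relay_region Loc t n c u w} \<and>
     eta s = F u pmax \<inter> (\<Inter>w\<in>found s. F u pmax - relay_region Loc t n c u w)"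

lemma smecn_invariant_init:
  assumes "p0 u \<le> pmax"
  shows "smecn_invariant V Loc t n c F pmax u (smecn_init F pmax p0 u)"
  using assms by (simp add: smecn_invariant_def smecn_init_def)

lemma smecn_invariant_step:
  assumes "\<And>p. p \<le> pmax \<Longrightarrow> Increase u p \<le> pmax"
    and "\<And>p. p \<le> pmax \<Longrightarrow> F u p \<subseteq> F u pmax"
    and inv: "smecn_invariant V Loc t n c F pmax u s"
  shows "smecn_invariant V Loc t n c F pmax u (smecn_step V Loc t n c F pmax Increase u s)"
proof -
  have "cur_power s \<le> pmax"
    using inv by (simp add: smecn_invariant_def)
  then have p: "Increase u (cur_power s) \<le> pmax"
    by (rule assms(1))
  then have sub: "F u (Increase u (cur_power s)) \<subseteq> F u pmax"
    by (rule assms(2))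
  show ?thesis
    \<comment> \<open>\<open>INT_Un\<close> splits the intersection over the old and the new nodes,
      as in the update of \<open>eta\<close>.\<close>
    using inv p sub unfolding smecn_invariant_def smecn_step_def Let_def
    by (simp add: INT_Un) blast
qed

lemma cur_power_smecn_step_funpow:
  "cur_power ((smecn_step V Loc t n c F pmax Increase u ^^ k) s) = (Increase u ^^ k) (cur_power s)"
  by (induction k) (simp_all add: smecn_step_def Let_def)

text \<open>The last step has added every node within reach of the power it set. For
  \<open>k = 0\<close> this can fail: initially nothing is found, whatever \<open>F u (p0 u)\<close>
  contains.\<close>

lemma found_smecn_step_funpow:
  assumes "k > 0" "s' = (smecn_step V Loc t n c F pmax Increase u ^^ k) s"
  shows "{v \<in> V. v \<noteq> u \<and> Loc v \<in> F u (cur_power s')} \<subseteq> found s'"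
  using assms by (cases k) (auto simp: smecn_step_def Let_def)

lemma smecn_terminates:
  assumes mono: "\<And>p. p \<le> pmax \<Longrightarrow> F u p \<subseteq> F u pmax"
    and p0: "p0 u \<le> pmax"
    and Increase: "\<And>p. p \<le> pmax \<Longrightarrow> Increase u p \<le> pmax"
    and ev: "eventually (\<lambda>k. (Increase u ^^ k) (p0 u) = pmax) sequentially"
    and start: "\<not> F u (p0 u) \<supseteq> F u pmax"
  obtains s where
    "smecn_nbrs V Loc t n c F pmax p0 Increase u = found s - non_nbrs s"
    "smecn_invariant V Loc t n c F pmax u s"
    "eta s \<subseteq> F u (cur_power s)"
    "{v \<in> V. v \<noteq> u \<and> Loc v \<in> F u (cur_power s)} \<subseteq> found s"
proof -
  let ?b = "smecn_continue F u"
  let ?f = "smecn_step V Loc t n c F pmax Increase u"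
  let ?i = "smecn_init F pmax p0 u"
  have inv: "smecn_invariant V Loc t n c F pmax u ((?f ^^ k) ?i)" for k
    by (induction k) (auto intro: smecn_invariant_init smecn_invariant_step p0 Increase dest: mono[THEN subsetD])
  obtain K where "(Increase u ^^ K) (p0 u) = pmax"
    using ev by (auto simp: eventually_sequentially)
  then have "cur_power ((?f ^^ K) ?i) = pmax"
    by (simp add: cur_power_smecn_step_funpow smecn_init_def)
  \<comment> \<open>By the invariant \<open>eta\<close> never leaves \<open>F u pmax\<close>, so the
    guard fails at full power.\<close>
  then have "\<not> ?b ((?f ^^ K) ?i)"
    using inv[of K] by (auto simp: smecn_continue_def smecn_invariant_def)
  then obtain s where s: "while_option ?b ?f ?i = Some s"
    by (metis while_option_def)
  then obtain k where k: "s = (?f ^^ k) ?i" and stop: "\<not> ?b s"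
    using while_option_stop2 by metis
  \<comment> \<open>The body runs at least once, so the final state comes from a broadcast at its
    current power.\<close>
  have "?b ?i"
    using start by (simp add: smecn_continue_def smecn_init_def)
  then have "k > 0"
    using k stop by (cases k) auto
  show ?thesis
  proof
    show "smecn_nbrs V Loc t n c F pmax p0 Increase u = found s - non_nbrs s"
      by (simp add: smecn_nbrs_def while_def s)
    show "smecn_invariant V Loc t n c F pmax u s"
      unfolding k by (rule inv)
    show "eta s \<subseteq> F u (cur_power s)"
      using stop by (simp add: smecn_continue_def)
    show "{v \<in> V. v \<noteq> u \<and> Loc v \<in> F u (cur_power s)} \<subseteq> found s"
      using \<open>k > 0\<close> k by (rule found_smecn_step_funpow)
  qed
qed

theorem mainTheorem3:
  fixes V :: "'a set" and Loc :: "'a \<Rightarrow> plane"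
    and t n c pmax :: real
    and G' :: "'a pair_pre_digraph"
    and F :: "'a \<Rightarrow> real \<Rightarrow> plane set"
    and p0 :: "'a \<Rightarrow> real" and Increase :: "'a \<Rightarrow> real \<Rightarrow> real"
  assumes "finite V" and "inj_on Loc V"
    and "t > 0" and "n \<ge> 2" and "c > 0"
    and "pair_loopfree_digraph G'" and "pverts G' = V"
    and max_power: "\<And>u v. (u, v) \<in> parcs G' \<Longrightarrow> transmit_power t n (Loc u) (Loc v) \<le> pmax"
    and connected: "\<And>u v. u \<in> V \<Longrightarrow> v \<in> V \<Longrightarrow> \<exists>r. pre_digraph.awalk G' u r v"
    and F_mono: "\<And>u p p'. u \<in> V \<Longrightarrow> p \<le> p' \<Longrightarrow> p' \<le> pmax \<Longrightarrow> F u p \<subseteq> F u p'"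
    and arcs_F: "\<And>u v. u \<in> V \<Longrightarrow> v \<in> V \<Longrightarrow> v \<noteq> u \<Longrightarrow> (u, v) \<in> parcs G' \<longleftrightarrow> Loc v \<in> F u pmax"
    and relay: "\<And>u v w. (u, v) \<in> parcs G' \<Longrightarrow> w \<in> V \<Longrightarrow> Loc v \<in> relay_region Loc t n c u w
                  \<Longrightarrow> two_redundant Loc t n c G' (u, v)"
    and p0_le: "\<And>u. u \<in> V \<Longrightarrow> p0 u \<le> pmax"
    and Increase_le: "\<And>u p. u \<in> V \<Longrightarrow> p \<le> pmax \<Longrightarrow> Increase u p \<le> pmax"
    and Increase_max: "\<And>u. u \<in> V \<Longrightarrow> eventually (\<lambda>k. (Increase u ^^ k) (p0 u) = pmax) sequentially"
    and p0_F: "\<And>u. u \<in> V \<Longrightarrow> \<not> F u (p0 u) \<supseteq> F u pmax"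
  shows "minimum_energy_property Loc t n c G' (smecn_graph V Loc t n c F pmax p0 Increase)"
proof -
  let ?N = "smecn_nbrs V Loc t n c F pmax p0 Increase"
  let ?G = "smecn_graph V Loc t n c F pmax p0 Increase"
  interpret pair_loopfree_digraph G' by fact
  have arc_verts: "u \<in> V" "v \<in> V" "v \<noteq> u" if "(u, v) \<in> parcs G'" for u v
    using that \<open>pverts G' = V\<close> arc_fst_in_verts[of "(u, v)"] arc_snd_in_verts[of "(u, v)"]
      pair_no_loops[of "(u, v)"] by auto
  have run: "\<exists>s. ?N u = found s - non_nbrs s \<and> smecn_invariant V Loc t n c F pmax u s \<and>
      eta s \<subseteq> F u (cur_power s) \<and> {v \<in> V. v \<noteq> u \<and> Loc v \<in> F u (cur_power s)} \<subseteq> found s"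
    if "u \<in> V" for u
    by (rule smecn_terminates[of pmax F u p0 Increase V Loc t n c])
      (use that F_mono[OF that _ order_refl] p0_le Increase_le Increase_max p0_F in blast)+
  have G_sub: "v \<in> V \<and> (u, v) \<in> parcs G'" if "(u, v) \<in> parcs ?G" for u v
  proof -
    have "u \<in> V" "v \<in> ?N u"
      using that by (auto simp: smecn_graph_def)
    \<comment> \<open>Found nodes are within reach at \<open>pmax\<close>, which
      \<open>arcs_F\<close> translates into arcs of \<open>G'\<close>.\<close>
    then have "v \<in> V" "v \<noteq> u" "Loc v \<in> F u pmax"
      using run[of u] by (auto simp: smecn_invariant_def)
    then show ?thesis
      using arcs_F \<open>u \<in> V\<close> by blast
  qed
  have G_sup: "(u, v) \<in> parcs ?G"
    if arc: "(u, v) \<in> parcs G'" and "\<not> two_redundant Loc t n c G' (u, v)" for u v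
  proof -
    note uv = arc_verts[OF arc]
    have no_relay: "Loc v \<notin> relay_region Loc t n c u w" if "w \<in> V" for w
      using relay[OF arc that] \<open>\<not> two_redundant Loc t n c G' (u, v)\<close> by blast
    obtain s where s: "?N u = found s - non_nbrs s" "smecn_invariant V Loc t n c F pmax u s"
        "eta s \<subseteq> F u (cur_power s)" "{v \<in> V. v \<noteq> u \<and> Loc v \<in> F u (cur_power s)} \<subseteq> found s"
      using run[OF \<open>u \<in> V\<close>] by blast
    have "Loc v \<in> eta s"
      using s(2) no_relay arc arcs_F[of u v] uv by (auto simp: smecn_invariant_def)
    then have "v \<in> found s"
      using s(3,4) uv by blast
    moreover have "v \<notin> non_nbrs s"
      using s(2) no_relay by (auto simp: smecn_invariant_def)
    ultimately show ?thesis
      using s(1) uv by (simp add: smecn_graph_def)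
  qed
  have verts_G: "pverts ?G = V"
    by (simp add: smecn_graph_def)
  have "pair_wf_digraph ?G"
    by unfold_locales (use G_sub arc_verts verts_G in force)+
  then have "spanning ?G G'"
    using G_sub verts_G \<open>pverts G' = V\<close> pair_wf_digraph_axioms
    by (auto simp: spanning_def subgraph_def compatible_def wf_digraph_wp_iff)
  moreover have "\<exists>r. pre_digraph.awalk ?G u r v \<and> minimum_energy_path Loc t n c G' u r v"
    if "u \<in> V" "v \<in> V" for u v
  proof -
    have "parcs G' \<subseteq> V \<times> V"
      using arc_verts by auto
    then have fin: "finite (parcs G')"
      using \<open>finite V\<close> by (meson finite_SigmaI finite_subset)
    obtain r0 where "awalk u r0 v"
      using connected[OF \<open>u \<in> V\<close> \<open>v \<in> V\<close>] by blast
    then obtain r where r: "minimum_energy_path Loc t n c G' u r v"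
      and longest: "\<And>r'. minimum_energy_path Loc t n c G' u r' v \<Longrightarrow> length r' \<le> length r"
      using ex_longest_minimum_energy_path[OF fin, of t c u r0 v Loc n] \<open>t > 0\<close> \<open>c > 0\<close> by auto
    have walk: "awalk u r v"
      using r by (simp add: minimum_energy_path_def)
    have "set r \<subseteq> parcs ?G"
    proof
      fix e assume "e \<in> set r"
      then have "\<not> two_redundant Loc t n c G' e"
        using longest_minimum_energy_path_not_two_redundant[OF pair_wf_digraph_axioms r longest] by blast
      moreover have "e \<in> parcs G'"
        using walk \<open>e \<in> set r\<close> by (auto simp: awalk_def)
      ultimately show "e \<in> parcs ?G"
        using G_sup by (cases e) blast
    qed
    \<comment> \<open>Consecutiveness of arcs (\<open>cas\<close>) depends only on their endpoints,
      and the node sets agree, so the inclusion of arcs suffices.\<close>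
    then have "pre_digraph.awalk ?G u r v"
      using walk that verts_G by (simp add: pre_digraph.awalk_def cas_with_proj_eq)
    with r show ?thesis
      by blast
  qed
  ultimately show ?thesis
    by (simp add: minimum_energy_property_def \<open>pverts G' = V\<close>)
qed

end
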